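(* Let $\nu>\frac{1}{2}$. Then, for all $x>0$, $$\mathbf{L}_{\nu}(x)-a_{\nu-1,0}\,x^{\nu+1}<\frac{x^{\nu+1}}{\sqrt{\pi}\,2^{\nu}\Gamma(\nu+\frac{1}{2})}\,{}_2F_3\bigg(1,1;\frac{3}{2},2,\nu+\frac{1}{2};\frac{x^2}{4}\bigg)<2\nu\, \mathbf{L}_\nu(x)-(2\nu-1)\mathbf{L}_{\nu+2}(x)+b_{\nu-1,0}\,x^{\nu+3}-c_{\nu-1,0}\,x^{\nu+1}.$$
   Context: For real $\nu$ and $x>0$, the modified Struve function of the first kind is $$\mathbf{L}_\nu(x)=\sum_{k=0}^\infty \frac{\big(\frac{1}{2}x\big)^{\nu+2k+1}}{\Gamma(k+\frac{3}{2})\Gamma(k+\nu+\frac{3}{2})}.$$ The generalized hypergeometric function is $${}_pF_q\big(a_1,\ldots,a_p;b_1,\ldots,b_q;x\big)=\sum_{k=0}^\infty \frac{(a_1)_k\cdots(a_p)_k}{(b_1)_k\cdots(b_q)_k}\frac{x^k}{k!},$$ where $(a)_0=1$ and $(a)_k=a(a+1)\cdots(a+k-1)$ for $k\geq1$. The constants are $$a_{\nu,n}=\frac{2\nu+n+1}{\sqrt{\pi}\,2^{\nu+n+2}(n+2)(\nu+n+1)\Gamma(\nu+n+\frac{5}{2})},$$ $$b_{\nu,n}=\frac{(2\nu+n+1)(2\nu+n+3)}{\sqrt{\pi}\,2^{\nu+n+4}(n+1)(n+4)(\nu+n+3)\Gamma(\nu+n+\frac{9}{2})},$$ $$c_{\nu,n}=\frac{2\nu+n+1}{\sqrt{\pi}\,2^{\nu+n+1}(n+1)(n+2)\Gamma(\nu+n+\frac{5}{2})};$$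 in the claim they are used with $\nu$ replaced by $\nu-1$ and $n=0$. *)

theory Defs
  imports "HOL-Analysis.Analysis"
begin

(* The powers have real exponents, hence powr; it is used for x > 0 only.
   Isabelle's total Gamma has the value 0 at its poles and x / 0 = 0, so that 1 / Gamma
   vanishes there, which is the usual convention for this series. *)
definition struve_L :: "real \<Rightarrow> real \<Rightarrow> real" where
  "struve_L \<nu> x =
     (\<Sum>k. (x / 2) powr (\<nu> + 2 * real k + 1) / (Gamma (real k + 3/2) * Gamma (real k + \<nu> + 3/2)))"

(* The third argument of fps_hypergeo scales the variable: coefficient k carries a factor 1 ^ k. *)
definition pFq :: "real list \<Rightarrow> real list \<Rightarrow> real \<Rightarrow> real" where
  "pFq as bs x = eval_fps (fps_hypergeo as bs 1) x"

lemma pFq_altdef: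
  "pFq as bs x =
     (\<Sum>k. (\<Prod>a\<leftarrow>as. pochhammer a k) / (\<Prod>b\<leftarrow>bs. pochhammer b k) * (x ^ k / fact k))"
proof -
  have foldl_eq: "foldl (\<lambda>r a. r * pochhammer a k) c as = c * (\<Prod>a\<leftarrow>as. pochhammer a k)"
    for as :: "real list" and c k
    by (induction as arbitrary: c) (simp_all add: mult.assoc)
  show ?thesis
    by (simp add: pFq_def eval_fps_def foldl_eq)
qed

definition a_const :: "real \<Rightarrow> real \<Rightarrow> real" where
  "a_const \<nu> n =
     (2 * \<nu> + n + 1) /
     (sqrt pi * 2 powr (\<nu> + n + 2) * (n + 2) * (\<nu> + n + 1) * Gamma (\<nu> + n + 5/2))"

definition b_const :: "real \<Rightarrow> real \<Rightarrow> real" where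
  "b_const \<nu> n =
     ((2 * \<nu> + n + 1) * (2 * \<nu> + n + 3)) /
     (sqrt pi * 2 powr (\<nu> + n + 4) * (n + 1) * (n + 4) * (\<nu> + n + 3) * Gamma (\<nu> + n + 9/2))"

definition c_const :: "real \<Rightarrow> real \<Rightarrow> real" where
  "c_const \<nu> n =
     (2 * \<nu> + n + 1) /
     (sqrt pi * 2 powr (\<nu> + n + 1) * (n + 1) * (n + 2) * Gamma (\<nu> + n + 5/2))"

end

theory Submission
  imports Defs
begin

text \<open>
  After division by \<open>(x / 2) powr (\<nu> + 1)\<close>, every function in the statement is a power series in
  \<open>(x / 2)\<^sup>2\<close>, and the inequalities hold coefficient by coefficient. Let
  \<open>A\<^sub>k = 1 / (Gamma (k + 3/2) * Gamma (k + \<nu> + 3/2)) > 0\<close> be the coefficients of the Struve function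
  of order \<open>\<nu>\<close>. The functional equation of \<open>Gamma\<close> expresses all other coefficients through them:
  the hypergeometric expression has the coefficients \<open>A\<^sub>k * (k + \<nu> + 1/2) / (k + 1)\<close>
  (lemma \<open>hypergeo_sums\<close>), and the Struve function of order \<open>\<nu> + 2\<close>, which starts one power
  of \<open>(x / 2)\<^sup>2\<close> later, has the coefficients \<open>A\<^sub>k * (k + 1/2) / (k + \<nu> + 3/2)\<close> for \<open>k \<ge> 1\<close>
  (lemma \<open>struve_L_add_2_sums\<close>).

  For the lower bound, the hypergeometric coefficient exceeds \<open>A\<^sub>k\<close> by
  \<open>A\<^sub>k * (\<nu> - 1/2) / (k + 1) > 0\<close>. For the upper bound, the difference of the coefficients for
  \<open>k \<ge> 1\<close> is \<open>(2 * \<nu> - 1) * A\<^sub>k * (k + 1/2) * (1 / (k + 1) - 1 / (k + \<nu> + 3/2)) > 0\<close>, and the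
  term with \<open>c_const\<close> is exactly what makes the constant coefficients equal. The terms with
  \<open>a_const\<close> and \<open>b_const\<close> are positive and only widen the resulting bounds.
\<close>

definition struve_coeff :: "real \<Rightarrow> nat \<Rightarrow> real" where
  "struve_coeff \<nu> k = 1 / (Gamma (real k + 3/2) * Gamma (real k + \<nu> + 3/2))"

lemma struve_coeff_pos: "\<nu> > -3/2 \<Longrightarrow> struve_coeff \<nu> k > 0"
  by (simp add: struve_coeff_def Gamma_real_pos)

lemma Gamma_real_step: "(z :: real) > 0 \<Longrightarrow> Gamma (z + 1) = z * Gamma z"
  by (rule Gamma_plus1) (auto elim!: nonpos_Ints_cases)

lemma Gamma_three_halves: "Gamma (3/2 :: real) = sqrt pi / 2"
  using Gamma_real_step[of "1/2"] by (simp add: Gamma_one_half_real)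

lemma struve_coeff_Suc:
  assumes "\<nu> > -3/2"
  shows "struve_coeff \<nu> (Suc k) = struve_coeff \<nu> k / ((real k + 3/2) * (real k + \<nu> + 3/2))"
  using assms Gamma_real_step[of "real k + 3/2"] Gamma_real_step[of "real k + \<nu> + 3/2"]
  by (simp add: struve_coeff_def algebra_simps)

lemma struve_coeff_add_2:
  assumes "\<nu> > -3/2"
  shows "struve_coeff (\<nu> + 2) k
           = struve_coeff \<nu> (Suc k) * (real (Suc k) + 1/2) / (real (Suc k) + \<nu> + 3/2)"
proof -
  define p q where "p = real k + 3/2" and "q = real k + \<nu> + 5/2"
  have pos: "p > 0" "q > 0" using assms by (auto simp: p_def q_def)
  have args: "real k + 3/2 = p" "real k + (\<nu> + 2) + 3/2 = q + 1"
             "real (Suc k) + 3/2 = p + 1" "real (Suc k) + \<nu> + 3/2 = q" "real (Suc k) + 1/2 = p"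
    by (auto simp: p_def q_def)
  show ?thesis
    unfolding struve_coeff_def args using pos by (simp add: Gamma_real_step)
qed

lemma summable_struve_coeff:
  assumes "\<nu> > -3/2"
  shows "summable (\<lambda>k. struve_coeff \<nu> k * (t::real) ^ (2 * k))"
proof -
  \<comment> \<open>Successive terms have the ratio \<open>t\<^sup>2 / ((k + 3/2) * (k + \<nu> + 3/2))\<close>. From \<open>k = 1\<close> on the second
    factor is at least 1, so \<open>k \<ge> 2 * t\<^sup>2\<close> makes the ratio at most \<open>1/2\<close>.\<close>
  define N where "N = max 1 (nat \<lceil>2 * t\<^sup>2\<rceil>)"
  show ?thesis
  proof (rule summable_ratio_test[where c = "1/2" and N = N])
    fix k assume "k \<ge> N"
    hence k: "real k \<ge> 1" "real k \<ge> 2 * t\<^sup>2"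
      unfolding N_def by linarith+
    define d where "d = (real k + 3/2) * (real k + \<nu> + 3/2)"
    have "real k * 1 \<le> d"
      unfolding d_def using assms k by (intro mult_mono) auto
    hence d: "d > 0" "t\<^sup>2 / d \<le> 1/2"
      using k by (auto simp: field_simps)
    have "norm (struve_coeff \<nu> (Suc k) * t ^ (2 * Suc k))
            = (t\<^sup>2 / d) * norm (struve_coeff \<nu> k * t ^ (2 * k))"
      using d(1) struve_coeff_pos[OF assms, of k]
      by (simp add: struve_coeff_Suc[OF assms] d_def[symmetric] abs_mult power_add power2_eq_square)
    also have "\<dots> \<le> 1/2 * norm (struve_coeff \<nu> k * t ^ (2 * k))"
      by (intro mult_right_mono d(2)) simp
    finally show "norm (struve_coeff \<nu> (Suc k) * t ^ (2 * Suc k))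
                    \<le> 1/2 * norm (struve_coeff \<nu> k * t ^ (2 * k))" .
  qed simp
qed

lemma struve_L_sums:
  assumes "\<nu> > -3/2" "x > 0"
  shows "(\<lambda>k. struve_coeff \<nu> k * (x / 2) ^ (2 * k)) sums (struve_L \<nu> x / (x / 2) powr (\<nu> + 1))"
proof -
  have term_eq: "(x / 2) powr (\<nu> + 2 * real k + 1) / (Gamma (real k + 3/2) * Gamma (real k + \<nu> + 3/2))
          = (x / 2) powr (\<nu> + 1) * (struve_coeff \<nu> k * (x / 2) ^ (2 * k))" for k
  proof -
    have "(x / 2) powr (\<nu> + 2 * real k + 1) = (x / 2) powr (\<nu> + 1) * (x / 2) powr real (2 * k)"
      by (subst powr_add[symmetric]) (simp add: algebra_simps)
    also have "(x / 2) powr real (2 * k) = (x / 2) ^ (2 * k)"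
      using assms by (intro powr_realpow) auto
    finally show ?thesis by (simp add: struve_coeff_def)
  qed
  have "struve_L \<nu> x = (x / 2) powr (\<nu> + 1) * (\<Sum>k. struve_coeff \<nu> k * (x / 2) ^ (2 * k))"
    unfolding struve_L_def term_eq by (rule suminf_mult[OF summable_struve_coeff[OF assms(1)]])
  thus ?thesis
    using assms summable_sums[OF summable_struve_coeff[OF assms(1), of "x / 2"]] by simp
qed

text \<open>
  The index is shifted so that this series can be compared with the one of order \<open>\<nu>\<close>: the two
  extra powers of \<open>x / 2\<close> move its \<open>k\<close>-th coefficient to position \<open>Suc k\<close> and leave position \<open>0\<close>
  empty.
\<close>
lemma struve_L_add_2_sums:
  assumes "\<nu> > -3/2" "x > 0"
  shows "(\<lambda>k. if k = 0 then 0
               else struve_coeff \<nu> k * (real k + 1/2) / (real k + \<nu> + 3/2) * (x / 2) ^ (2 * k))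
           sums (struve_L (\<nu> + 2) x / (x / 2) powr (\<nu> + 1))"
    (is "?f sums _")
proof -
  have "(\<lambda>k. (x / 2)\<^sup>2 * (struve_coeff (\<nu> + 2) k * (x / 2) ^ (2 * k)))
          sums ((x / 2)\<^sup>2 * (struve_L (\<nu> + 2) x / (x / 2) powr (\<nu> + 2 + 1)))"
    using assms by (intro sums_mult struve_L_sums) auto
  also have "(\<lambda>k. (x / 2)\<^sup>2 * (struve_coeff (\<nu> + 2) k * (x / 2) ^ (2 * k))) = (\<lambda>k. ?f (Suc k))"
  proof
    fix k
    have "(x / 2) ^ (2 * Suc k) = (x / 2)\<^sup>2 * (x / 2) ^ (2 * k)"
      by (simp add: power2_eq_square)
    thus "(x / 2)\<^sup>2 * (struve_coeff (\<nu> + 2) k * (x / 2) ^ (2 * k)) = ?f (Suc k)"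
      unfolding struve_coeff_add_2[OF assms(1)]
      by (simp only: nat.simps if_False mult_ac)
  qed
  also have "(x / 2) powr (\<nu> + 2 + 1) = (x / 2) powr (\<nu> + 1) * (x / 2)\<^sup>2"
  proof -
    have "(x / 2) powr (\<nu> + 2 + 1) = (x / 2) powr (\<nu> + 1) * (x / 2) powr real 2"
      by (subst powr_add[symmetric]) (simp add: algebra_simps)
    thus ?thesis using assms by (subst (asm) powr_realpow) auto
  qed
  finally have "(\<lambda>k. ?f (Suc k)) sums (struve_L (\<nu> + 2) x / (x / 2) powr (\<nu> + 1))"
    using assms by simp
  thus ?thesis by (subst (asm) sums_Suc_iff) simp
qed

text \<open>
  Since \<open>(1)\<^sub>k = k!\<close> and \<open>(2)\<^sub>k = (k + 1)!\<close>, these Pochhammer symbols and the \<open>k!\<close> of the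
  hypergeometric series combine to \<open>1 / (k + 1)\<close>; the two remaining symbols are quotients of
  \<open>Gamma\<close> values whose denominators cancel against the prefactor, because
  \<open>Gamma (3/2) = sqrt pi / 2\<close>.
\<close>
lemma hypergeo_sums:
  assumes "\<nu> > -1/2" "x > 0"
  shows "(\<lambda>k. struve_coeff \<nu> k * (real k + \<nu> + 1/2) / (real k + 1) * (x / 2) ^ (2 * k))
           sums (x powr (\<nu> + 1) / (sqrt pi * 2 powr \<nu> * Gamma (\<nu> + 1/2))
                   * pFq [1, 1] [3/2, 2, \<nu> + 1/2] (x\<^sup>2 / 4) / (x / 2) powr (\<nu> + 1))"
    (is "?f sums _")
proof -
  define C where "C = 2 / (sqrt pi * Gamma (\<nu> + 1/2))"
  define g where "g k = (\<Prod>a\<leftarrow>[1, 1]. pochhammer a k) / (\<Prod>b\<leftarrow>[3/2, 2, \<nu> + 1/2]. pochhammer b k)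
                          * ((x\<^sup>2 / 4) ^ k / fact k)" for k
  have G: "Gamma (\<nu> + 1/2) > 0" using assms by (intro Gamma_real_pos) auto
  have prefactor: "x powr (\<nu> + 1) / (sqrt pi * 2 powr \<nu> * Gamma (\<nu> + 1/2)) = C * (x / 2) powr (\<nu> + 1)"
    using assms G by (simp add: C_def powr_divide powr_add field_simps)
  have f_eq: "?f k = C * g k" for k
  proof -
    have "pochhammer (2::real) k = fact (Suc k)"
      using pochhammer_rec[of "1::real" k] by (simp add: pochhammer_fact[symmetric])
    hence p2: "pochhammer (2::real) k = (real k + 1) * fact k" by (simp add: algebra_simps)
    have "pochhammer (3/2::real) k = Gamma (3/2 + real k) / Gamma (3/2)"
      by (intro pochhammer_Gamma) (auto elim!: nonpos_Ints_cases)
    hence p3: "pochhammer (3/2::real) k = Gamma (real k + 3/2) * 2 / sqrt pi"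
      by (simp add: Gamma_three_halves add.commute)
    have "\<nu> + 1/2 \<notin> \<int>\<^sub>\<le>\<^sub>0"
      using assms nonpos_Ints_nonpos[of "\<nu> + 1/2"] by linarith
    hence p4: "pochhammer (\<nu> + 1/2) k = Gamma (real k + \<nu> + 1/2) / Gamma (\<nu> + 1/2)"
      using pochhammer_Gamma[of "\<nu> + 1/2" k] by (simp add: add_ac)
    have Gs: "Gamma (real k + \<nu> + 3/2) = (real k + \<nu> + 1/2) * Gamma (real k + \<nu> + 1/2)"
      using assms Gamma_real_step[of "real k + \<nu> + 1/2"] by (simp add: algebra_simps)
    have pos: "Gamma (real k + \<nu> + 1/2) > 0" "Gamma (real k + 3/2) > 0" "real k + \<nu> + 1/2 > 0"
      using assms by (auto intro!: Gamma_real_pos)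
    have pw: "(x / 2) ^ (2 * k) = (x\<^sup>2 / 4) ^ k"
      by (simp add: power_mult power_divide)
    have "?f k = 1 / (Gamma (real k + 3/2) * Gamma (real k + \<nu> + 1/2) * (real k + 1)) * (x\<^sup>2 / 4) ^ k"
      unfolding struve_coeff_def Gs pw using pos by simp
    also have "\<dots> = C * g k"
    proof -
      define G0 Gk H w where "G0 = Gamma (\<nu> + 1/2)" and "Gk = Gamma (real k + \<nu> + 1/2)"
        and "H = Gamma (real k + 3/2)" and "w = (x\<^sup>2 / 4) ^ k"
      have "g k = fact k * fact k / (H * 2 / sqrt pi * ((real k + 1) * fact k) * (Gk / G0)) * (w / fact k)"
        unfolding g_def H_def Gk_def G0_def w_def by (simp add: p2 p3 p4 pochhammer_fact[symmetric])
      moreover have "G0 > 0" "Gk > 0" "H > 0"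
        using G pos by (simp_all only: G0_def Gk_def H_def)
      ultimately show ?thesis
        unfolding C_def H_def[symmetric] Gk_def[symmetric] G0_def[symmetric] w_def[symmetric]
        by (simp add: divide_simps mult_ac)
    qed
    finally show ?thesis .
  qed
  \<comment> \<open>The quotient by \<open>k + 1\<close> is bounded in \<open>k\<close>, so convergence is inherited from the Struve series.\<close>
  have "summable ?f"
  proof (rule summable_comparison_test')
    show "summable (\<lambda>k. (\<nu> + 3/2) * (struve_coeff \<nu> k * (x / 2) ^ (2 * k)))"
      using assms by (intro summable_mult summable_struve_coeff) auto
    fix k :: nat
    define r where "r = (real k + \<nu> + 1/2) / (real k + 1)"
    have "(\<nu> + 3/2) * (real k + 1) = (real k + \<nu> + 1/2) + ((\<nu> + 1/2) * real k + 1)"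
      by (simp add: algebra_simps)
    moreover have "0 \<le> (\<nu> + 1/2) * real k" using assms by (intro mult_nonneg_nonneg) auto
    ultimately have "real k + \<nu> + 1/2 \<le> (\<nu> + 3/2) * (real k + 1)" by linarith
    hence r: "0 \<le> r" "r \<le> \<nu> + 3/2"
      using assms by (auto simp: r_def pos_divide_le_eq)
    have nonneg: "0 \<le> struve_coeff \<nu> k * (x / 2) ^ (2 * k)"
      using assms struve_coeff_pos[of \<nu> k] by simp
    have "?f k = r * (struve_coeff \<nu> k * (x / 2) ^ (2 * k))" by (simp add: r_def)
    thus "norm (?f k) \<le> (\<nu> + 3/2) * (struve_coeff \<nu> k * (x / 2) ^ (2 * k))"
      using r nonneg by (simp only: real_norm_def abs_of_nonneg mult_nonneg_nonneg mult_right_mono)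
  qed
  hence "summable (\<lambda>k. C * g k)"
    by (simp only: f_eq)
  moreover have "C \<noteq> 0"
    using G by (simp add: C_def)
  ultimately have "summable g"
    using summable_cmult_iff[of C g] by simp
  hence "(\<lambda>k. C * g k) sums (C * (\<Sum>k. g k))"
    by (intro sums_mult summable_sums)
  moreover have "pFq [1, 1] [3/2, 2, \<nu> + 1/2] (x\<^sup>2 / 4) = (\<Sum>k. g k)"
    unfolding pFq_altdef g_def ..
  moreover have "(x / 2) powr (\<nu> + 1) \<noteq> 0"
    using assms by simp
  ultimately show ?thesis
    unfolding f_eq prefactor by simp
qed

lemma struve_L_less_hypergeo:
  assumes "\<nu> > 1/2" "x > 0"
  shows "struve_L \<nu> x < x powr (\<nu> + 1) / (sqrt pi * 2 powr \<nu> * Gamma (\<nu> + 1/2))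
                           * pFq [1, 1] [3/2, 2, \<nu> + 1/2] (x\<^sup>2 / 4)"
    (is "_ < ?M")
proof -
  define P where "P = (x / 2) powr (\<nu> + 1)"
  have "P > 0" using assms by (simp add: P_def)
  have sums: "(\<lambda>k. struve_coeff \<nu> k * (real k + \<nu> + 1/2) / (real k + 1) * (x / 2) ^ (2 * k)
              - struve_coeff \<nu> k * (x / 2) ^ (2 * k)) sums (?M / P - struve_L \<nu> x / P)"
    (is "?d sums _")
    unfolding P_def using assms by (intro sums_diff hypergeo_sums struve_L_sums) auto
  have "?d k > 0" for k
  proof -
    define w where "w = (real k + \<nu> + 1/2) / (real k + 1)"
    have "w - 1 = (\<nu> - 1/2) / (real k + 1)"
      by (simp add: w_def field_simps)
    hence "w - 1 > 0"
      using assms by simp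
    moreover have "?d k = struve_coeff \<nu> k * (x / 2) ^ (2 * k) * (w - 1)"
      unfolding right_diff_distrib by (simp add: w_def)
    ultimately show ?thesis
      using assms struve_coeff_pos[of \<nu> k] by simp
  qed
  hence "0 < suminf ?d"
    by (intro suminf_pos sums_summable[OF sums])
  hence "struve_L \<nu> x / P < ?M / P"
    unfolding sums_unique[OF sums, symmetric] by (simp only: diff_gt_0_iff_gt)
  thus ?thesis
    using \<open>P > 0\<close> unfolding divide_less_cancel by blast
qed

text \<open>
  The constant coefficients of \<open>2 * \<nu>\<close> times the Struve series and of the hypergeometric series are
  \<open>2 * \<nu> * A\<^sub>0\<close> and \<open>(\<nu> + 1/2) * A\<^sub>0\<close>, while the series of order \<open>\<nu> + 2\<close> contributes nothing
  there; so \<open>(\<nu> - 1/2) * A\<^sub>0\<close> is the amount that separates them.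
\<close>
lemma c_const_eq:
  assumes "\<nu> > -3/2" "x > 0"
  shows "c_const (\<nu> - 1) 0 * x powr (\<nu> + 1) = (\<nu> - 1/2) * struve_coeff \<nu> 0 * (x / 2) powr (\<nu> + 1)"
proof -
  have "Gamma (\<nu> + 3/2) > 0" using assms by (intro Gamma_real_pos) auto
  thus ?thesis
    using assms Gamma_three_halves
    by (simp add: c_const_def struve_coeff_def powr_divide powr_add field_simps)
qed

lemma hypergeo_less_struve_L:
  assumes "\<nu> > 1/2" "x > 0"
  shows "x powr (\<nu> + 1) / (sqrt pi * 2 powr \<nu> * Gamma (\<nu> + 1/2))
             * pFq [1, 1] [3/2, 2, \<nu> + 1/2] (x\<^sup>2 / 4)
           < 2 * \<nu> * struve_L \<nu> x - (2 * \<nu> - 1) * struve_L (\<nu> + 2) x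
               - c_const (\<nu> - 1) 0 * x powr (\<nu> + 1)"
    (is "?M < _")
proof -
  define P where "P = (x / 2) powr (\<nu> + 1)"
  have "P > 0" using assms by (simp add: P_def)
  define q where "q k = (x / 2) ^ (2 * k)" for k
  define A where "A = struve_coeff \<nu>"
  let ?s = "\<lambda>k. if k = 0 then 0 else A k * (real k + 1/2) / (real k + \<nu> + 3/2) * q k"
  let ?c = "\<lambda>k. if k = 0 then (\<nu> - 1/2) * A 0 else 0"
  define d where "d = (\<lambda>k. 2 * \<nu> * (A k * q k) - (2 * \<nu> - 1) * ?s k - ?c k
                          - A k * (real k + \<nu> + 1/2) / (real k + 1) * q k)"
  let ?D = "2 * \<nu> * (struve_L \<nu> x / P) - (2 * \<nu> - 1) * (struve_L (\<nu> + 2) x / P)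
              - (\<nu> - 1/2) * A 0 - ?M / P"
  have sums: "d sums ?D"
    unfolding d_def P_def q_def A_def using assms
    by (intro sums_diff sums_mult hypergeo_sums struve_L_sums struve_L_add_2_sums sums_single) auto
  have d0: "d 0 = 0"
    by (simp add: d_def q_def algebra_simps)
  have dpos: "d k > 0" if "k > 0" for k
  proof -
    define r where "r = real k"
    have r: "r > 0" using that by (simp add: r_def)
    define u v where "u = 1 / (r + 1)" and "v = 1 / (r + \<nu> + 3/2)"
    have "d k = 2 * \<nu> * (A k * q k) - (2 * \<nu> - 1) * (A k * (r + 1/2) * v * q k)
                   - A k * (r + \<nu> + 1/2) * u * q k"
      using that by (simp add: d_def r_def u_def v_def)
    also have "\<dots> = A k * q k * (2 * \<nu> - (2 * \<nu> - 1) * ((r + 1/2) * v) - (r + \<nu> + 1/2) * u)"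
      by (simp add: field_simps)
    also have "(r + \<nu> + 1/2) * u = 1 + (\<nu> - 1/2) * u"
      using r by (simp add: u_def field_simps)
    also have "2 * \<nu> - (2 * \<nu> - 1) * ((r + 1/2) * v) - (1 + (\<nu> - 1/2) * u)
                 = (2 * \<nu> - 1) * ((1 - u / 2) - (r + 1/2) * v)"
      by (simp add: algebra_simps)
    also have "1 - u / 2 = (r + 1/2) * u"
      using r by (simp add: u_def field_simps)
    finally have "d k = A k * q k * ((2 * \<nu> - 1) * ((r + 1/2) * (u - v)))"
      by (simp only: right_diff_distrib)
    moreover have "A k > 0" "q k > 0"
      using assms struve_coeff_pos[of \<nu> k] by (simp_all add: A_def q_def)
    moreover have "u - v > 0"
      using assms r by (simp add: u_def v_def frac_less2)
    ultimately show ?thesis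
      using assms r by simp
  qed
  have "d k \<ge> 0" for k
    using d0 dpos[of k] by (cases "k = 0") auto
  hence "0 < suminf d"
    using dpos[of 1] by (intro suminf_pos2[of d 1] sums_summable[OF sums]) auto
  hence "0 < ?D"
    using sums_unique[OF sums] by simp
  hence "0 < ?D * P" using \<open>P > 0\<close> by simp
  also have "?D * P = 2 * \<nu> * struve_L \<nu> x - (2 * \<nu> - 1) * struve_L (\<nu> + 2) x
                        - c_const (\<nu> - 1) 0 * x powr (\<nu> + 1) - ?M"
  proof -
    have "(a * (s / P) - b * (t / P) - e - m / P) * P = a * s - b * t - e * P - m" for a b s t e m
      using \<open>P > 0\<close> by (simp add: left_diff_distrib)
    moreover have "c_const (\<nu> - 1) 0 * x powr (\<nu> + 1) = (\<nu> - 1/2) * A 0 * P"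
      using assms c_const_eq[of \<nu> x] by (simp add: A_def P_def)
    ultimately show ?thesis
      by (simp only:)
  qed
  finally show ?thesis by simp
qed

lemma a_const_pos: "\<nu> > 1/2 \<Longrightarrow> a_const (\<nu> - 1) 0 > 0"
  by (auto simp: a_const_def intro!: divide_pos_pos mult_pos_pos Gamma_real_pos)

lemma b_const_pos: "\<nu> > 1/2 \<Longrightarrow> b_const (\<nu> - 1) 0 > 0"
  by (auto simp: b_const_def intro!: divide_pos_pos mult_pos_pos Gamma_real_pos)

theorem corollary2p4:
  fixes \<nu> x :: real
  assumes "\<nu> > 1/2" and "x > 0"
  shows "struve_L \<nu> x - a_const (\<nu> - 1) 0 * x powr (\<nu> + 1)
           < x powr (\<nu> + 1) / (sqrt pi * 2 powr \<nu> * Gamma (\<nu> + 1/2))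
               * pFq [1, 1] [3/2, 2, \<nu> + 1/2] (x\<^sup>2 / 4)
       \<and> x powr (\<nu> + 1) / (sqrt pi * 2 powr \<nu> * Gamma (\<nu> + 1/2))
             * pFq [1, 1] [3/2, 2, \<nu> + 1/2] (x\<^sup>2 / 4)
           < 2 * \<nu> * struve_L \<nu> x - (2 * \<nu> - 1) * struve_L (\<nu> + 2) x
               + b_const (\<nu> - 1) 0 * x powr (\<nu> + 3) - c_const (\<nu> - 1) 0 * x powr (\<nu> + 1)"
proof -
  have "a_const (\<nu> - 1) 0 * x powr (\<nu> + 1) > 0" "b_const (\<nu> - 1) 0 * x powr (\<nu> + 3) > 0"
    using assms a_const_pos b_const_pos by simp_all
  with struve_L_less_hypergeo[OF assms] hypergeo_less_struve_L[OF assms] show ?thesis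
    by linarith
qed

end
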